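(* The estimator-based computation of second order arithmetical truth is well-defined and agrees with actual truth. That is: let $\sigma$ be a sentence of second order arithmetic, and let $\theta$ be a sentence of the form $Q_1X_1\,Q_2X_2\cdots Q_{n-1}X_{n-1}\,\exists X_n\,\forall x\,\exists y>x\ P$ with $n>0$, obtained from $\sigma$ or from $\neg\sigma$ by the standard equivalence-preserving conversion, where each $Q_i$ is a quantifier $\forall$ or $\exists$, each $X_i$ is a set of natural numbers, and $P$ is a bounded quantifier formula (in $y,X_1,\dots,X_n$) that does not use $x$. Then there is a valid notion $R$ of $n$-estimators such that for every $e\in R$: $\theta$ passes $e$ if and only if $\theta$ is true. (Thus, if $\theta$ was obtained from $\sigma$, then $\sigma$ is true iff $\theta$ passes $e$, and if $\theta$ was obtained from $\neg\sigma$, then $\sigma$ is true iff $\theta$ does not pass $e$, for every $e\in R$.)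
   Context: Valid notions of estimators, defined by recursion on the level: * A notion (set) $R$ of $0$-estimators is valid iff $R$ is a set of pairs of natural numbers and there are $a_{\min}\in\mathbb{N}$ and $f\in\mathbb{N}^{\mathbb{N}}$ such that $(a,b)\in R\Leftrightarrow a\ge a_{\min}\wedge b\ge f(a)$. * A notion (set) $R$ of $(m+1)$-estimators is valid iff (1) every element of $R$ is a finite set; (2) $\bigcup R$ is a valid notion of $m$-estimators, and $x\in R\wedge y\in\bigcup R\Rightarrow x\cup\{y\}\in R$; (3) for every valid notion $S$ of $m$-estimators there is $r\in R$ with $r\subseteq S$. A statement using a (sufficiently good) $n$-estimator as a parameter is well-defined iff there is a valid notion $R$ of $n$-estimators all of whose elements agree on whether it is true; this common value is then its truth value. Passing an estimator, for formulas with already chosen values (infinite binary sequences) for their free set variables; a formula with $m$ leading set quantifiers is evaluated at a level $m$ estimator: * $\forall x\,\exists y>x\ P(y,\ldots)$ passes a level $0$ estimator $(a,b)$ iff $\exists y\,(a\le y<b)\ P(y,\ldots)$. * $\forall X\,\varphi(X)$ passes a level $m+1$ estimator $e$ iff for every binary sequence $X$, $\varphi(X)$ passes at least one of the level $m$ estimators in $e$. * $\exists X\,\varphi(X)$ passes a level $m+1$ estimator $e$ iff for some binary sequence $X$, $\varphi(X)$ passes all of the level $m$ estimators in $e$. *)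

theory Defs
  imports Main "HOL-Library.FSet"
begin

section \<open>Second order arithmetic\<close>

text \<open>
  Number variables and set variables are named by natural numbers, in two separate name spaces.
\<close>

datatype num_term =
    Zero
  | One
  | NVar nat
  | Plus num_term num_term
  | Times num_term num_term

datatype formula =
    Equal num_term num_term
  | Less num_term num_term
  | Member num_term nat
  | Neg formula
  | Conj formula formula
  | Disj formula formula
  | Impl formula formula
  | AllN nat formula
  | ExN nat formula
  | AllS nat formula
  | ExS nat formula

primrec term_vars :: "num_term \<Rightarrow> nat set" where
  "term_vars Zero = {}"
| "term_vars One = {}"
| "term_vars (NVar x) = {x}"
| "term_vars (Plus s t) = term_vars s \<union> term_vars t"
| "term_vars (Times s t) = term_vars s \<union> term_vars t"

primrec free_num_vars :: "formula \<Rightarrow> nat set" where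
  "free_num_vars (Equal s t) = term_vars s \<union> term_vars t"
| "free_num_vars (Less s t) = term_vars s \<union> term_vars t"
| "free_num_vars (Member t X) = term_vars t"
| "free_num_vars (Neg \<phi>) = free_num_vars \<phi>"
| "free_num_vars (Conj \<phi> \<psi>) = free_num_vars \<phi> \<union> free_num_vars \<psi>"
| "free_num_vars (Disj \<phi> \<psi>) = free_num_vars \<phi> \<union> free_num_vars \<psi>"
| "free_num_vars (Impl \<phi> \<psi>) = free_num_vars \<phi> \<union> free_num_vars \<psi>"
| "free_num_vars (AllN x \<phi>) = free_num_vars \<phi> - {x}"
| "free_num_vars (ExN x \<phi>) = free_num_vars \<phi> - {x}"
| "free_num_vars (AllS X \<phi>) = free_num_vars \<phi>"
| "free_num_vars (ExS X \<phi>) = free_num_vars \<phi>"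

primrec free_set_vars :: "formula \<Rightarrow> nat set" where
  "free_set_vars (Equal s t) = {}"
| "free_set_vars (Less s t) = {}"
| "free_set_vars (Member t X) = {X}"
| "free_set_vars (Neg \<phi>) = free_set_vars \<phi>"
| "free_set_vars (Conj \<phi> \<psi>) = free_set_vars \<phi> \<union> free_set_vars \<psi>"
| "free_set_vars (Disj \<phi> \<psi>) = free_set_vars \<phi> \<union> free_set_vars \<psi>"
| "free_set_vars (Impl \<phi> \<psi>) = free_set_vars \<phi> \<union> free_set_vars \<psi>"
| "free_set_vars (AllN x \<phi>) = free_set_vars \<phi>"
| "free_set_vars (ExN x \<phi>) = free_set_vars \<phi>"
| "free_set_vars (AllS X \<phi>) = free_set_vars \<phi> - {X}"
| "free_set_vars (ExS X \<phi>) = free_set_vars \<phi> - {X}"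

definition sentence :: "formula \<Rightarrow> bool" where
  "sentence \<phi> \<longleftrightarrow> free_num_vars \<phi> = {} \<and> free_set_vars \<phi> = {}"

text \<open>
  Truth is truth in the full standard model. A set of natural numbers is represented by its
  characteristic function, that is, by an infinite binary sequence.
\<close>

type_synonym num_assignment = "nat \<Rightarrow> nat"
type_synonym set_assignment = "nat \<Rightarrow> nat \<Rightarrow> bool"

primrec term_val :: "num_assignment \<Rightarrow> num_term \<Rightarrow> nat" where
  "term_val N Zero = 0"
| "term_val N One = 1"
| "term_val N (NVar x) = N x"
| "term_val N (Plus s t) = term_val N s + term_val N t"
| "term_val N (Times s t) = term_val N s * term_val N t"

primrec sat :: "num_assignment \<Rightarrow> set_assignment \<Rightarrow> formula \<Rightarrow> bool" where
  "sat N V (Equal s t) \<longleftrightarrow> term_val N s = term_val N t"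
| "sat N V (Less s t) \<longleftrightarrow> term_val N s < term_val N t"
| "sat N V (Member t X) \<longleftrightarrow> V X (term_val N t)"
| "sat N V (Neg \<phi>) \<longleftrightarrow> \<not> sat N V \<phi>"
| "sat N V (Conj \<phi> \<psi>) \<longleftrightarrow> sat N V \<phi> \<and> sat N V \<psi>"
| "sat N V (Disj \<phi> \<psi>) \<longleftrightarrow> sat N V \<phi> \<or> sat N V \<psi>"
| "sat N V (Impl \<phi> \<psi>) \<longleftrightarrow> (sat N V \<phi> \<longrightarrow> sat N V \<psi>)"
| "sat N V (AllN x \<phi>) \<longleftrightarrow> (\<forall>k. sat (N(x := k)) V \<phi>)"
| "sat N V (ExN x \<phi>) \<longleftrightarrow> (\<exists>k. sat (N(x := k)) V \<phi>)"
| "sat N V (AllS X \<phi>) \<longleftrightarrow> (\<forall>A. sat N (V(X := A)) \<phi>)"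
| "sat N V (ExS X \<phi>) \<longleftrightarrow> (\<exists>A. sat N (V(X := A)) \<phi>)"

definition true_formula :: "formula \<Rightarrow> bool" where
  "true_formula \<phi> \<longleftrightarrow> (\<forall>N V. sat N V \<phi>)"

definition equivalent :: "formula \<Rightarrow> formula \<Rightarrow> bool" where
  "equivalent \<phi> \<psi> \<longleftrightarrow> (\<forall>N V. sat N V \<phi> \<longleftrightarrow> sat N V \<psi>)"

inductive bounded_formula :: "formula \<Rightarrow> bool" where
  "bounded_formula (Equal s t)"
| "bounded_formula (Less s t)"
| "bounded_formula (Member t X)"
| "bounded_formula \<phi> \<Longrightarrow> bounded_formula (Neg \<phi>)"
| "bounded_formula \<phi> \<Longrightarrow> bounded_formula \<psi> \<Longrightarrow> bounded_formula (Conj \<phi> \<psi>)"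
| "bounded_formula \<phi> \<Longrightarrow> bounded_formula \<psi> \<Longrightarrow> bounded_formula (Disj \<phi> \<psi>)"
| "bounded_formula \<phi> \<Longrightarrow> bounded_formula \<psi> \<Longrightarrow> bounded_formula (Impl \<phi> \<psi>)"
| "bounded_formula \<phi> \<Longrightarrow> z \<notin> term_vars t \<Longrightarrow>
     bounded_formula (AllN z (Impl (Less (NVar z) t) \<phi>))"
| "bounded_formula \<phi> \<Longrightarrow> z \<notin> term_vars t \<Longrightarrow>
     bounded_formula (ExN z (Conj (Less (NVar z) t) \<phi>))"

text \<open>The formula \<open>\<forall>x \<exists>y>x P\<close>.\<close>

definition inf_often :: "nat \<Rightarrow> nat \<Rightarrow> formula \<Rightarrow> formula" where
  "inf_often x y P = AllN x (ExN y (Conj (Less (NVar x) (NVar y)) P))"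

datatype quantifier = Forall | Exists

fun set_quantify :: "(quantifier \<times> nat) list \<Rightarrow> formula \<Rightarrow> formula" where
  "set_quantify [] \<phi> = \<phi>"
| "set_quantify ((Forall, X) # Qs) \<phi> = AllS X (set_quantify Qs \<phi>)"
| "set_quantify ((Exists, X) # Qs) \<phi> = ExS X (set_quantify Qs \<phi>)"

text \<open>
  The sentences \<open>Q\<^sub>1X\<^sub>1 \<dots> Q\<^bsub>n-1\<^esub>X\<^bsub>n-1\<^esub> \<exists>X\<^sub>n \<forall>x \<exists>y>x P\<close>. The conditions on the free variables of \<open>P\<close>,
  with \<open>x \<noteq> y\<close>, say in particular that \<open>P\<close> does not use \<open>x\<close>.
\<close>

definition normal_form :: "nat \<Rightarrow> formula \<Rightarrow> bool" where
  "normal_form n \<theta> \<longleftrightarrow>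
     (\<exists>Qs X x y P.
        n = length Qs + 1 \<and>
        \<theta> = set_quantify Qs (ExS X (inf_often x y P)) \<and>
        distinct (map snd Qs @ [X]) \<and>
        x \<noteq> y \<and>
        bounded_formula P \<and>
        free_num_vars P \<subseteq> {y} \<and>
        free_set_vars P \<subseteq> insert X (snd ` set Qs))"


section \<open>Estimators\<close>

text \<open>
  Estimators of all levels live in one type: pairs of natural numbers at level 0, finite sets of
  level \<open>m\<close> estimators at level \<open>m + 1\<close>. Levels are sorted out by \<open>valid_notion\<close>.
\<close>

datatype estimator =
    Base nat nat
  | FinSet "estimator fset"

primrec elements :: "estimator \<Rightarrow> estimator set" where
  "elements (Base a b) = {}"
| "elements (FinSet E) = fset E"

text \<open>
  In the successor case the set \<open>\<Union>R\<close> is \<open>\<Union>(elements ` R)\<close>, and being a finite set is being of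
  the form \<open>FinSet x\<close>.
\<close>

primrec valid_notion :: "nat \<Rightarrow> estimator set \<Rightarrow> bool" where
  "valid_notion 0 R \<longleftrightarrow>
     (\<exists>a\<^sub>m\<^sub>i\<^sub>n (f :: nat \<Rightarrow> nat). R = {Base a b | a b. a \<ge> a\<^sub>m\<^sub>i\<^sub>n \<and> b \<ge> f a})"
| "valid_notion (Suc m) R \<longleftrightarrow>
     (\<forall>e\<in>R. \<exists>x. e = FinSet x) \<and>
     valid_notion m (\<Union>(elements ` R)) \<and>
     (\<forall>x y. FinSet x \<in> R \<and> y \<in> \<Union>(elements ` R) \<longrightarrow> FinSet (finsert y x) \<in> R) \<and>
     (\<forall>S. valid_notion m S \<longrightarrow> (\<exists>r\<in>R. elements r \<subseteq> S))"

text \<open>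
  Passing an estimator, relative to values of the free variables. Each rule covers one shape of
  formula, so by rule inversion each is an equivalence; nothing passes an estimator of the wrong
  level. The induction is well-founded on the formula, so least and greatest fixed point agree.
\<close>

inductive passes_at ::
  "num_assignment \<Rightarrow> set_assignment \<Rightarrow> formula \<Rightarrow> estimator \<Rightarrow> bool" where
  inf_often:
    "\<exists>k. a \<le> k \<and> k < b \<and> sat (N(y := k)) V P \<Longrightarrow>
       passes_at N V (inf_often x y P) (Base a b)"
| AllS:
    "\<forall>A. \<exists>e\<in>fset E. passes_at N (V(X := A)) \<phi> e \<Longrightarrow>
       passes_at N V (AllS X \<phi>) (FinSet E)"
| ExS:
    "\<exists>A. \<forall>e\<in>fset E. passes_at N (V(X := A)) \<phi> e \<Longrightarrow>
       passes_at N V (ExS X \<phi>) (FinSet E)"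

definition passes :: "formula \<Rightarrow> estimator \<Rightarrow> bool" where
  "passes \<theta> e \<longleftrightarrow> (\<forall>N V. passes_at N V \<theta> e)"

lemma passes_at_inf_often:
  "passes_at N V (inf_often x y P) (Base a b) \<longleftrightarrow> (\<exists>k. a \<le> k \<and> k < b \<and> sat (N(y := k)) V P)"
  by (subst passes_at.simps) (auto simp: inf_often_def)

lemma passes_at_AllS:
  "passes_at N V (AllS X \<phi>) (FinSet E) \<longleftrightarrow> (\<forall>A. \<exists>e\<in>fset E. passes_at N (V(X := A)) \<phi> e)"
  by (subst passes_at.simps) (auto simp: inf_often_def)

lemma passes_at_ExS:
  "passes_at N V (ExS X \<phi>) (FinSet E) \<longleftrightarrow> (\<exists>A. \<forall>e\<in>fset E. passes_at N (V(X := A)) \<phi> e)"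
  by (subst passes_at.simps) (auto simp: inf_often_def)

end

theory Submission
  imports Defs
begin

text \<open>
  For fixed values of the set variables, the truth value of a formula is witnessed by some valid
  notion all of whose elements agree with it. A true existential (or false universal) formula
  inherits a notion from an instance, by passing to finite subsets. For a true universal (or false
  existential) formula one takes the finite sets of estimators that contain, for every value of the
  quantified variable, an estimator giving the right answer. Such a set exists inside every valid
  notion because any two valid notions meet, and because passing a given estimator depends on
  finitely many bits only, so that Cantor space is covered by finitely many clopen sets.
\<close>

section \<open>Finite dependence\<close>

text \<open>Compactness by Koenig's lemma, with \<open>K\<close> allowed to vary with
  \<open>e\<close>. If no finite part of \<open>S\<close> suffices, bad prefixes extend bit by bit
  forever. Some \<open>e\<close> in \<open>S\<close> handles the limit sequence, hence also a whole
  neighbourhood of it, so a long enough prefix was not bad.\<close>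

lemma cantor_space_finite_subcover:
  fixes Q :: "(nat \<Rightarrow> bool) \<Rightarrow> 'a \<Rightarrow> bool"
  assumes det: "\<And>e. \<exists>K. \<forall>A B. (\<forall>k<K. A k = B k) \<longrightarrow> Q A e = Q B e"
    and cover: "\<And>A. \<exists>e\<in>S. Q A e"
  shows "\<exists>F. finite F \<and> F \<subseteq> S \<and> (\<forall>A. \<exists>e\<in>F. Q A e)"
proof -
  \<comment> \<open>Only the first \<open>n\<close> bits of \<open>A\<close> matter here: the
    cylinder they determine has a finite subcover.\<close>
  define good where "good n A \<longleftrightarrow>
    (\<exists>F. finite F \<and> F \<subseteq> S \<and> (\<forall>B. (\<forall>k<n. B k = A k) \<longrightarrow> (\<exists>e\<in>F. Q B e)))" for n :: nat and A
  have split: "good n A" if good_Suc: "\<And>b. good (Suc n) (A(n := b))" for n A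
  proof -
    obtain F where F: "\<And>b. finite (F b) \<and> F b \<subseteq> S \<and>
        (\<forall>B. (\<forall>k<Suc n. B k = (A(n := b)) k) \<longrightarrow> (\<exists>e\<in>F b. Q B e))"
      using good_Suc unfolding good_def by metis
    have "\<exists>e \<in> F True \<union> F False. Q B e" if "\<forall>k<n. B k = A k" for B
    proof -
      have "\<forall>k<Suc n. B k = (A(n := B n)) k"
        using that by (auto simp: less_Suc_eq)
      then have "\<exists>e\<in>F (B n). Q B e"
        using F by blast
      then show ?thesis
        by (cases "B n") auto
    qed
    then show ?thesis
      unfolding good_def using F by (intro exI[of _ "F True \<union> F False"]) auto
  qed
  have "good 0 (\<lambda>_. True)"
  proof (rule ccontr)
    assume "\<not> good 0 (\<lambda>_. True)"
    \<comment> \<open>Stage \<open>Suc n\<close> rewrites only bit \<open>n\<close>, so the bits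
      below \<open>n\<close> are frozen from stage \<open>n\<close> on.\<close>
    then have "\<exists>f. \<forall>n. \<not> good n (f n) \<and> (\<exists>b. f (Suc n) = (f n)(n := b))"
      by (intro dependent_nat_choice) (use split in blast)+
    then obtain f where bad: "\<And>n. \<not> good n (f n)"
      and step: "\<And>n. \<exists>b. f (Suc n) = (f n)(n := b)"
      by blast
    \<comment> \<open>Bit \<open>k\<close> is read at the first stage at which it is final.\<close>
    define A where "A k = f (Suc k) k" for k
    have prefix: "\<forall>k<n. f n k = A k" for n
    proof (induction n)
      case (Suc n)
      then show ?case
        using step[of n] by (auto simp: less_Suc_eq A_def)
    qed simp
    obtain e where e: "e \<in> S" "Q A e"
      using cover by blast
    obtain K where K: "\<forall>A B. (\<forall>k<K. A k = B k) \<longrightarrow> Q A e = Q B e"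
      using det by blast
    have "Q B e" if "\<forall>k<K. B k = f K k" for B
    proof -
      have "\<forall>k<K. A k = B k"
        using that prefix[of K] by simp
      then show ?thesis
        using K e by blast
    qed
    then have "good K (f K)"
      unfolding good_def using e by (intro exI[of _ "{e}"]) auto
    then show False
      using bad by blast
  qed
  then show ?thesis
    unfolding good_def by auto
qed

section \<open>Predicates of set assignments that depend on finitely many bits of each set\<close>

definition agree :: "nat \<Rightarrow> set_assignment \<Rightarrow> set_assignment \<Rightarrow> bool" where
  "agree K V W \<longleftrightarrow> (\<forall>X. \<forall>k<K. V X k = W X k)"

text \<open>The bound \<open>K\<close> is uniform in the assignments and, through
  \<open>agree\<close>, in the set variables; this uniformity is what set quantifiers will
  need.\<close>

definition finitely_determined :: "(set_assignment \<Rightarrow> bool) \<Rightarrow> bool" where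
  "finitely_determined Q \<longleftrightarrow> (\<exists>K. \<forall>V W. agree K V W \<longrightarrow> Q V = Q W)"

lemma agree_mono: "agree K V W \<Longrightarrow> L \<le> K \<Longrightarrow> agree L V W"
  by (auto simp: agree_def)

lemma finitely_determined_const: "finitely_determined (\<lambda>_. c)"
  by (auto simp: finitely_determined_def)

lemma finitely_determined_app: "finitely_determined (\<lambda>V. V X k)"
  unfolding finitely_determined_def agree_def by (intro exI[of _ "Suc k"]) auto

lemma finitely_determined_not: "finitely_determined Q \<Longrightarrow> finitely_determined (\<lambda>V. \<not> Q V)"
  by (auto simp: finitely_determined_def)

lemma finitely_determined_Ball:
  assumes "finite I" and "\<And>i. i \<in> I \<Longrightarrow> finitely_determined (Q i)"
  shows "finitely_determined (\<lambda>V. \<forall>i\<in>I. Q i V)"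
proof -
  obtain K where K: "\<And>i V W. i \<in> I \<Longrightarrow> agree (K i) V W \<Longrightarrow> Q i V = Q i W"
    using assms(2) unfolding finitely_determined_def by metis
  have "(\<forall>i\<in>I. Q i V) = (\<forall>i\<in>I. Q i W)" if "agree (Max (K ` I)) V W" for V W
  proof -
    have "Q i V = Q i W" if "i \<in> I" for i
      using that agree_mono[OF \<open>agree _ V W\<close>, of "K i"] assms(1) by (intro K) auto
    then show ?thesis
      by blast
  qed
  then show ?thesis
    unfolding finitely_determined_def by blast
qed

lemma finitely_determined_Bex:
  assumes "finite I" and "\<And>i. i \<in> I \<Longrightarrow> finitely_determined (Q i)"
  shows "finitely_determined (\<lambda>V. \<exists>i\<in>I. Q i V)"
proof -
  have "finitely_determined (\<lambda>V. \<not> (\<forall>i\<in>I. \<not> Q i V))"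
    by (intro finitely_determined_not finitely_determined_Ball assms)
  then show ?thesis
    by simp
qed

lemma finitely_determined_conj:
  assumes "finitely_determined Q" and "finitely_determined Q'"
  shows "finitely_determined (\<lambda>V. Q V \<and> Q' V)"
proof -
  \<comment> \<open>A conjunction is a finite universal quantification over the two
    booleans.\<close>
  have "finitely_determined (\<lambda>V. \<forall>b\<in>UNIV. if b then Q V else Q' V)"
  proof (rule finitely_determined_Ball)
    show "finitely_determined (\<lambda>V. if b then Q V else Q' V)" for b
      using assms by (cases b) simp_all
  qed simp
  moreover have "(\<forall>b\<in>UNIV. if b then Q V else Q' V) = (Q V \<and> Q' V)" for V
    by auto
  ultimately show ?thesis
    by simp
qed

lemma agree_fun_upd: "agree K V W \<Longrightarrow> agree K (V(X := A)) (W(X := A))"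
  by (auto simp: agree_def)

text \<open>The old bound still works: updating both assignments with the same \<open>A\<close>
  keeps them in agreement, and the bound does not depend on \<open>A\<close>. No compactness is
  involved.\<close>

lemma finitely_determined_all_sets:
  assumes "finitely_determined Q"
  shows "finitely_determined (\<lambda>V. \<forall>A. Q (V(X := A)))"
  using assms agree_fun_upd unfolding finitely_determined_def by meson

lemma finitely_determined_ex_set:
  assumes "finitely_determined Q"
  shows "finitely_determined (\<lambda>V. \<exists>A. Q (V(X := A)))"
  using finitely_determined_not[OF finitely_determined_all_sets[OF finitely_determined_not[OF assms]]]
  by simp

section \<open>Finite dependence of satisfaction and of passing\<close>

lemma term_val_cong:
  "(\<And>z. z \<in> term_vars t \<Longrightarrow> N z = M z) \<Longrightarrow> term_val N t = term_val M t"
  by (induction t) auto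

lemma sat_cong:
  assumes "\<And>z. z \<in> free_num_vars \<phi> \<Longrightarrow> N z = M z"
    and "\<And>X. X \<in> free_set_vars \<phi> \<Longrightarrow> V X = W X"
  shows "sat N V \<phi> = sat M W \<phi>"
  using assms
proof (induction \<phi> arbitrary: N M V W)
  case (Equal s t)
  then have "term_val N s = term_val M s" "term_val N t = term_val M t"
    by (auto intro!: term_val_cong)
  then show ?case by simp
next
  case (Less s t)
  then have "term_val N s = term_val M s" "term_val N t = term_val M t"
    by (auto intro!: term_val_cong)
  then show ?case by simp
next
  case (Member t X)
  then have "term_val N t = term_val M t"
    by (auto intro!: term_val_cong)
  then show ?case using Member.prems by simp
next
  case (Neg \<phi>)
  have "sat N V \<phi> = sat M W \<phi>"
    by (rule Neg.IH) (use Neg.prems in auto)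
  then show ?case by simp
next
  case (Conj \<phi> \<psi>)
  have "sat N V \<phi> = sat M W \<phi>"
    by (rule Conj.IH) (use Conj.prems in auto)
  moreover have "sat N V \<psi> = sat M W \<psi>"
    by (rule Conj.IH) (use Conj.prems in auto)
  ultimately show ?case by simp
next
  case (Disj \<phi> \<psi>)
  have "sat N V \<phi> = sat M W \<phi>"
    by (rule Disj.IH) (use Disj.prems in auto)
  moreover have "sat N V \<psi> = sat M W \<psi>"
    by (rule Disj.IH) (use Disj.prems in auto)
  ultimately show ?case by simp
next
  case (Impl \<phi> \<psi>)
  have "sat N V \<phi> = sat M W \<phi>"
    by (rule Impl.IH) (use Impl.prems in auto)
  moreover have "sat N V \<psi> = sat M W \<psi>"
    by (rule Impl.IH) (use Impl.prems in auto)
  ultimately show ?case by simp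
next
  case (AllN x \<phi>)
  have "sat (N(x := k)) V \<phi> = sat (M(x := k)) W \<phi>" for k
    by (rule AllN.IH) (use AllN.prems in auto)
  then show ?case by simp
next
  case (ExN x \<phi>)
  have "sat (N(x := k)) V \<phi> = sat (M(x := k)) W \<phi>" for k
    by (rule ExN.IH) (use ExN.prems in auto)
  then show ?case by simp
next
  case (AllS X \<phi>)
  have "sat N (V(X := A)) \<phi> = sat M (W(X := A)) \<phi>" for A
    by (rule AllS.IH) (use AllS.prems in auto)
  then show ?case by simp
next
  case (ExS X \<phi>)
  have "sat N (V(X := A)) \<phi> = sat M (W(X := A)) \<phi>" for A
    by (rule ExS.IH) (use ExS.prems in auto)
  then show ?case by simp
qed

text \<open>With \<open>N\<close> fixed, terms have fixed values, so a membership atom reads a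
  single bit and a bounded quantifier is a finite conjunction or disjunction.\<close>

lemma finitely_determined_bounded_formula:
  "bounded_formula \<phi> \<Longrightarrow> finitely_determined (\<lambda>V. sat N V \<phi>)"
proof (induction arbitrary: N rule: bounded_formula.induct)
  case (3 t X)
  then show ?case by (simp add: finitely_determined_app)
next
  case (4 \<phi>)
  then show ?case by (simp add: finitely_determined_not)
next
  case (5 \<phi> \<psi>)
  then show ?case by (simp add: finitely_determined_conj)
next
  case (6 \<phi> \<psi>)
  have "finitely_determined (\<lambda>V. \<not> (\<not> sat N V \<phi> \<and> \<not> sat N V \<psi>))"
    by (intro finitely_determined_not finitely_determined_conj 6)
  then show ?case by simp
next
  case (7 \<phi> \<psi>)
  have "finitely_determined (\<lambda>V. \<not> (sat N V \<phi> \<and> \<not> sat N V \<psi>))"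
    by (intro finitely_determined_not finitely_determined_conj 7)
  then show ?case by simp
next
  case (8 \<phi> z t)
  \<comment> \<open>Since \<open>z\<close> is not in \<open>t\<close>, the range of the quantifier
    is one finite set, the same for all \<open>k\<close> and all \<open>V\<close>.\<close>
  have "term_val (N(z := k)) t = term_val N t" for k
    using 8 by (intro term_val_cong) auto
  moreover have "finitely_determined (\<lambda>V. \<forall>k\<in>{..<term_val N t}. sat (N(z := k)) V \<phi>)"
    by (intro finitely_determined_Ball 8) simp
  ultimately show ?case by (simp add: Ball_def)
next
  case (9 \<phi> z t)
  have "term_val (N(z := k)) t = term_val N t" for k
    using 9 by (intro term_val_cong) auto
  moreover have "finitely_determined (\<lambda>V. \<exists>k\<in>{..<term_val N t}. sat (N(z := k)) V \<phi>)"
    by (intro finitely_determined_Bex 9) simp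
  ultimately show ?case by (simp add: Bex_def)
qed (simp_all add: finitely_determined_const)

lemma not_passes_at_wrong_level:
  "\<not> passes_at N V (inf_often x y P) (FinSet E)"
  "\<not> passes_at N V (AllS X \<phi>) (Base a b)"
  "\<not> passes_at N V (ExS X \<phi>) (Base a b)"
  by (subst passes_at.simps, simp add: inf_often_def)+

text \<open>A pair \<open>Base a b\<close> leaves finitely many candidates for the witness, and at
  higher levels the quantifier over estimators ranges over a finite set. Estimators of the wrong
  level give a constant predicate, so \<open>e\<close> can be arbitrary.\<close>

lemma finitely_determined_passes_at:
  assumes "bounded_formula P"
  shows "finitely_determined (\<lambda>V. passes_at N V (set_quantify Qs (inf_often x y P)) e)"
proof (induction Qs arbitrary: e)
  case Nil
  show ?case
  proof (cases e)
    case (Base a b)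
    have "finitely_determined (\<lambda>V. \<exists>k\<in>{a..<b}. sat (N(y := k)) V P)"
      by (intro finitely_determined_Bex finitely_determined_bounded_formula assms) simp
    then show ?thesis
      by (simp add: Base passes_at_inf_often Bex_def conj_assoc)
  qed (simp add: not_passes_at_wrong_level finitely_determined_const)
next
  case (Cons q Qs)
  obtain Q X where q: "q = (Q, X)"
    by fastforce
  show ?case
  proof (cases e)
    case (Base a b)
    then show ?thesis
      by (cases Q) (simp_all add: q not_passes_at_wrong_level finitely_determined_const)
  next
    case (FinSet E)
    let ?p = "\<lambda>V e. passes_at N V (set_quantify Qs (inf_often x y P)) e"
    have "finitely_determined (\<lambda>V. \<forall>A. \<exists>e\<in>fset E. ?p (V(X := A)) e)"
      by (intro finitely_determined_all_sets[of "\<lambda>V. \<exists>e\<in>fset E. ?p V e"]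
          finitely_determined_Bex Cons.IH) simp
    moreover have "finitely_determined (\<lambda>V. \<exists>A. \<forall>e\<in>fset E. ?p (V(X := A)) e)"
      by (intro finitely_determined_ex_set[of "\<lambda>V. \<forall>e\<in>fset E. ?p V e"]
          finitely_determined_Ball Cons.IH) simp
    ultimately show ?thesis
      by (cases Q) (simp_all add: q FinSet passes_at_AllS passes_at_ExS)
  qed
qed

section \<open>Valid notions\<close>

text \<open>The largest valid notion of each level. It is also the union of the notion of hitting
  sets one level up.\<close>

primrec all_estimators :: "nat \<Rightarrow> estimator set" where
  "all_estimators 0 = {Base a b | a b. True}"
| "all_estimators (Suc m) = {FinSet x | x. fset x \<subseteq> all_estimators m}"

lemma valid_notion_SucD:
  assumes "valid_notion (Suc m) R"
  shows "e \<in> R \<Longrightarrow> \<exists>x. e = FinSet x"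
    and "valid_notion m (\<Union>(elements ` R))"
    and "FinSet x \<in> R \<Longrightarrow> y \<in> \<Union>(elements ` R) \<Longrightarrow> FinSet (finsert y x) \<in> R"
    and "valid_notion m S \<Longrightarrow> \<exists>x. FinSet x \<in> R \<and> fset x \<subseteq> S"
proof -
  have R: "\<forall>e\<in>R. \<exists>x. e = FinSet x"
      "valid_notion m (\<Union>(elements ` R))"
      "\<forall>x y. FinSet x \<in> R \<and> y \<in> \<Union>(elements ` R) \<longrightarrow> FinSet (finsert y x) \<in> R"
      "\<forall>S. valid_notion m S \<longrightarrow> (\<exists>r\<in>R. elements r \<subseteq> S)"
    using assms[unfolded valid_notion.simps] by - (elim conjE, assumption)+
  show FinSet: "e \<in> R \<Longrightarrow> \<exists>x. e = FinSet x" for e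
    using R(1) by blast
  show "valid_notion m (\<Union>(elements ` R))"
    by (fact R(2))
  show "FinSet x \<in> R \<Longrightarrow> y \<in> \<Union>(elements ` R) \<Longrightarrow> FinSet (finsert y x) \<in> R"
    using R(3) by (simp only: simp_thms)
  assume "valid_notion m S"
  then obtain r where r: "r \<in> R" "elements r \<subseteq> S"
    using R(4) by (elim allE[of _ S]) (erule impE, assumption, erule bexE)
  then show "\<exists>x. FinSet x \<in> R \<and> fset x \<subseteq> S"
    using FinSet[OF r(1)] by auto
qed

text \<open>Recovers the levels, which the type \<open>estimator\<close> does not record; finite
  parts of valid notions thereby become candidates for hitting sets.\<close>

lemma valid_notion_subset: "valid_notion m R \<Longrightarrow> R \<subseteq> all_estimators m"
proof (induction m arbitrary: R)
  case (Suc m)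
  have union: "\<Union>(elements ` R) \<subseteq> all_estimators m"
    by (rule Suc.IH[OF valid_notion_SucD(2)[OF Suc.prems]])
  show ?case
  proof
    fix e assume e: "e \<in> R"
    then obtain x where "e = FinSet x"
      using valid_notion_SucD(1)[OF Suc.prems] by blast
    moreover from this have "fset x \<subseteq> \<Union>(elements ` R)"
      using e by force
    ultimately show "e \<in> all_estimators (Suc m)"
      using union by auto
  qed
qed auto

text \<open>Singletons make the union equal to \<open>R\<close>, and the empty set lies inside every
  \<open>S\<close>. This notion serves the cases decided by a single instance of the set
  quantifier.\<close>

lemma valid_notion_finite_subsets:
  assumes "valid_notion m R"
  shows "valid_notion (Suc m) {FinSet x | x. fset x \<subseteq> R}" (is "valid_notion _ ?R")
proof -
  have "e \<in> \<Union>(elements ` ?R)" if "e \<in> R" for e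
    using that by (intro UN_I[of "FinSet {|e|}"]) auto
  then have union: "\<Union>(elements ` ?R) = R"
    by auto
  show ?thesis
    unfolding valid_notion.simps union
  proof (intro conjI allI impI)
    show "\<exists>r\<in>?R. elements r \<subseteq> S" for S
      by (intro bexI[of _ "FinSet {||}"]) auto
  qed (use assms in auto)
qed

lemma valid_all_estimators: "valid_notion m (all_estimators m)"
proof (induction m)
  case 0
  show ?case
    unfolding valid_notion.simps by (rule exI[of _ 0], rule exI[of _ "\<lambda>_. 0"]) simp
next
  case (Suc m)
  then show ?case
    using valid_notion_finite_subsets[of m "all_estimators m"]
    by (simp only: all_estimators.simps)
qed

text \<open>Validity allows adding one element of the union at a time; finitely many follow by
  induction on \<open>y\<close>.\<close>

lemma valid_notion_union:
  assumes "valid_notion (Suc m) R" "FinSet x \<in> R" "fset y \<subseteq> \<Union>(elements ` R)"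
  shows "FinSet (x |\<union>| y) \<in> R"
  using assms(3)
proof (induction y)
  case (insert e y)
  then have "FinSet (finsert e (x |\<union>| y)) \<in> R"
    by (intro valid_notion_SucD(3)[OF assms(1)]) auto
  then show ?case by simp
qed (simp add: assms(2))

text \<open>No induction on the level is needed. Each notion has a member inside the union of the
  other, since that union is valid one level down. Closure under adding elements then puts the union
  of these two members into both notions.\<close>

lemma valid_notions_meet:
  assumes "valid_notion m R" "valid_notion m S"
  shows "\<exists>e. e \<in> R \<and> e \<in> S"
proof (cases m)
  case 0
  obtain a f where R: "R = {Base k b | k b. k \<ge> a \<and> b \<ge> f k}"
    using assms(1) 0 by auto
  obtain a' f' where S: "S = {Base k b | k b. k \<ge> a' \<and> b \<ge> f' k}"
    using assms(2) 0 by auto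
  show ?thesis
    unfolding R S
    \<comment> \<open>The second component has to dominate both functions at the common first
      component.\<close>
    by (intro exI[of _ "Base (max a a') (max (f (max a a')) (f' (max a a')))"]) auto
next
  case (Suc l)
  have R: "valid_notion (Suc l) R" and S: "valid_notion (Suc l) S"
    using assms Suc by simp_all
  obtain x where x: "FinSet x \<in> R" "fset x \<subseteq> \<Union>(elements ` S)"
    using valid_notion_SucD(4)[OF R valid_notion_SucD(2)[OF S]] by blast
  obtain y where y: "FinSet y \<in> S" "fset y \<subseteq> \<Union>(elements ` R)"
    using valid_notion_SucD(4)[OF S valid_notion_SucD(2)[OF R]] by blast
  have "FinSet (x |\<union>| y) \<in> R" "FinSet (y |\<union>| x) \<in> S"
    using valid_notion_union[OF R x(1) y(2)] valid_notion_union[OF S y(1) x(2)] by blast+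
  then show ?thesis
    by (auto simp: sup_commute)
qed

text \<open>The notion supplied by \<open>local\<close> may vary with \<open>A\<close>. A valid
  \<open>S\<close> meets each of them, so it contains a right estimator for every \<open>A\<close>,
  and compactness extracts finitely many that suffice. Enlarging a hitting set keeps it
  hitting.\<close>

lemma valid_notion_hitting_sets:
  fixes Q :: "(nat \<Rightarrow> bool) \<Rightarrow> estimator \<Rightarrow> bool"
  assumes det: "\<And>e. \<exists>K. \<forall>A B. (\<forall>k<K. A k = B k) \<longrightarrow> Q A e = Q B e"
    and local: "\<And>A. \<exists>R. valid_notion m R \<and> (\<forall>e\<in>R. Q A e)"
  shows "valid_notion (Suc m)
    {FinSet x | x. fset x \<subseteq> all_estimators m \<and> (\<forall>A. \<exists>e\<in>fset x. Q A e)}"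
    (is "valid_notion _ ?R")
proof -
  have hit: "\<exists>x. FinSet x \<in> ?R \<and> fset x \<subseteq> S" if S: "valid_notion m S" for S
  proof -
    have cover: "\<exists>e\<in>S. Q A e" for A
    proof -
      obtain R where R: "valid_notion m R" "\<forall>e\<in>R. Q A e"
        using local by blast
      obtain e where "e \<in> S" "e \<in> R"
        using valid_notions_meet[OF S R(1)] by blast
      then show ?thesis
        using R(2) by blast
    qed
    obtain F where F: "finite F" "F \<subseteq> S" "\<forall>A. \<exists>e\<in>F. Q A e"
      using cantor_space_finite_subcover[of Q S, OF det cover] by (elim exE conjE)
    have y: "fset (Abs_fset F) = F"
      using F(1) by (simp add: Abs_fset_inverse)
    define y where "y = Abs_fset F"
    note y = y[folded y_def]
    have "fset y \<subseteq> all_estimators m"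
      unfolding y using F(2) valid_notion_subset[OF S] by (rule subset_trans)
    moreover have "\<forall>A. \<exists>e\<in>fset y. Q A e"
      unfolding y by (rule F(3))
    ultimately have "FinSet y \<in> ?R"
      by simp
    then show ?thesis
      using F(2) y by (intro exI[of _ y]) simp
  qed
  \<comment> \<open>One hitting set is enough to compute the union: adjoining any estimator of level
    \<open>m\<close> to it gives another hitting set.\<close>
  obtain x where x: "FinSet x \<in> ?R"
    using hit[OF valid_all_estimators] by blast
  have union: "\<Union>(elements ` ?R) = all_estimators m"
  proof (intro equalityI subsetI)
    fix e assume "e \<in> \<Union>(elements ` ?R)"
    then show "e \<in> all_estimators m"
      by auto
  next
    fix e assume "e \<in> all_estimators m"
    with x have "FinSet (finsert e x) \<in> ?R"
      by auto
    then show "e \<in> \<Union>(elements ` ?R)"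
      by (rule UN_I) simp
  qed
  show ?thesis
    unfolding valid_notion.simps union
  proof (intro conjI allI impI ballI)
    show "valid_notion m (all_estimators m)"
      by (rule valid_all_estimators)
  next
    fix e assume "e \<in> ?R"
    then show "\<exists>x. e = FinSet x"
      by blast
  next
    fix x y assume "FinSet x \<in> ?R \<and> y \<in> all_estimators m"
    then show "FinSet (finsert y x) \<in> ?R"
      by auto
  next
    fix S assume "valid_notion m S"
    from hit[OF this] obtain x where "FinSet x \<in> ?R" "fset x \<subseteq> S"
      by (elim exE conjE)
    then show "\<exists>r\<in>?R. elements r \<subseteq> S"
      by (intro bexI[of _ "FinSet x"]) (simp_all only: elements.simps)
  qed
qed

section \<open>Agreement with truth\<close>

lemma sat_inf_often:
  assumes "x \<noteq> y" "x \<notin> free_num_vars P"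
  shows "sat N V (inf_often x y P) \<longleftrightarrow> (\<forall>j. \<exists>k>j. sat (N(y := k)) V P)"
proof -
  have "sat (N(x := j, y := k)) V P = sat (N(y := k)) V P" for j k
    using assms by (intro sat_cong) auto
  then show ?thesis
    using assms by (simp add: inf_often_def)
qed

lemma valid_notion_0: "valid_notion 0 {Base a b | a b. a \<ge> j \<and> b \<ge> f a}"
  unfolding valid_notion.simps by (rule exI[of _ j], rule exI[of _ f], rule refl)

text \<open>Truth is captured by a fast growing bound on \<open>b\<close>, taken from a Skolem
  function; falsity by a lower bound on \<open>a\<close> beyond all witnesses.\<close>

lemma ex_notion_inf_often:
  assumes "x \<noteq> y" "x \<notin> free_num_vars P"
  shows "\<exists>R. valid_notion 0 R \<and>
    (\<forall>e\<in>R. passes_at N V (inf_often x y P) e = sat N V (inf_often x y P))"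
proof (cases "sat N V (inf_often x y P)")
  case True
  then obtain g where g: "\<And>j. g j > j \<and> sat (N(y := g j)) V P"
    unfolding sat_inf_often[OF assms] by metis
  \<comment> \<open>The interval from \<open>a\<close> to \<open>b\<close> is half open, hence
    \<open>Suc\<close>.\<close>
  have "passes_at N V (inf_often x y P) (Base a b)" if "b \<ge> Suc (g a)" for a b
    unfolding passes_at_inf_often using g[of a] that by (intro exI[of _ "g a"]) auto
  then show ?thesis
    using True valid_notion_0[of 0 "\<lambda>a. Suc (g a)"] by blast
next
  case False
  then obtain j where j: "\<And>k. k > j \<Longrightarrow> \<not> sat (N(y := k)) V P"
    unfolding sat_inf_often[OF assms] by blast
  have "\<not> passes_at N V (inf_often x y P) (Base a b)" if "a \<ge> Suc j" for a b
    unfolding passes_at_inf_often using j that by (meson Suc_le_lessD less_le_trans)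
  then show ?thesis
    using False valid_notion_0[of "Suc j" "\<lambda>_. 0"] by blast
qed

text \<open>Induction on the prefix for all \<open>V\<close> at once: the notion depends on
  \<open>V\<close>, and stripping a quantifier leaves one notion for each value \<open>A\<close> of
  its variable.\<close>

lemma ex_notion_agreeing_with_sat:
  assumes "x \<noteq> y" "x \<notin> free_num_vars P" "bounded_formula P"
  shows "\<exists>R. valid_notion (length Qs) R \<and>
    (\<forall>e\<in>R. passes_at N V (set_quantify Qs (inf_often x y P)) e =
            sat N V (set_quantify Qs (inf_often x y P)))"
proof (induction Qs arbitrary: V)
  case Nil
  then show ?case
    using ex_notion_inf_often assms by simp
next
  case (Cons q Qs)
  obtain Q X where q: "q = (Q, X)"
    by fastforce
  define \<psi> where "\<psi> = set_quantify Qs (inf_often x y P)"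
  define p where "p A e = passes_at N (V(X := A)) \<psi> e" for A e
  define s where "s A = sat N (V(X := A)) \<psi>" for A
  have IH: "\<exists>R. valid_notion (length Qs) R \<and> (\<forall>e\<in>R. p A e = s A)" for A
    using Cons.IH unfolding p_def s_def \<psi>_def by blast
  have det: "\<exists>K. \<forall>A B. (\<forall>k<K. A k = B k) \<longrightarrow> p A e = p B e" for e
  proof -
    obtain K where K: "\<And>V W. agree K V W \<Longrightarrow> passes_at N V \<psi> e = passes_at N W \<psi> e"
      using finitely_determined_passes_at[OF assms(3)] unfolding finitely_determined_def \<psi>_def
      by blast
    have "p A e = p B e" if "\<forall>k<K. A k = B k" for A B
      unfolding p_def using that by (intro K) (simp add: agree_def)
    then show ?thesis
      by blast
  qed
  \<comment> \<open>A single \<open>A\<close> that settles the quantifier: \<open>E\<close> has only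
    estimators that judge this instance correctly. An empty \<open>E\<close> does no harm, as the
    condition is universal over \<open>E\<close>.\<close>
  have instance_notion: "\<exists>R. valid_notion (Suc (length Qs)) R \<and>
      (\<forall>e\<in>R. \<exists>E. e = FinSet E \<and> (\<forall>e'\<in>fset E. p A e' = s A))" for A
  proof -
    obtain R where R: "valid_notion (length Qs) R" "\<forall>e\<in>R. p A e = s A"
      using IH by blast
    show ?thesis
      by (rule exI, rule conjI, rule valid_notion_finite_subsets[OF R(1)]) (use R in blast)
  qed
  \<comment> \<open>The parameter \<open>c\<close> merges the dual cases: \<open>True\<close> for a
    true universal formula, \<open>False\<close> for a false existential one.\<close>
  have hitting_notion: "\<exists>R. valid_notion (Suc (length Qs)) R \<and>
      (\<forall>e\<in>R. \<exists>E. e = FinSet E \<and> (\<forall>A. \<exists>e'\<in>fset E. p A e' = c))" if "\<And>A. s A = c" for c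
  proof -
    have "\<exists>K. \<forall>A B. (\<forall>k<K. A k = B k) \<longrightarrow> (p A e = c) = (p B e = c)" for e
      using det[of e] by metis
    moreover have "\<exists>R. valid_notion (length Qs) R \<and> (\<forall>e\<in>R. p A e = c)" for A
      using IH[of A] that by simp
    ultimately show ?thesis
      using valid_notion_hitting_sets[of "\<lambda>A e. p A e = c" "length Qs"]
      by (intro exI[of _ "{FinSet x | x. fset x \<subseteq> all_estimators (length Qs) \<and>
            (\<forall>A. \<exists>e\<in>fset x. p A e = c)}"]) blast
  qed
  define \<theta> where "\<theta> = set_quantify (q # Qs) (inf_often x y P)"
  have "\<exists>R. valid_notion (Suc (length Qs)) R \<and> (\<forall>e\<in>R. passes_at N V \<theta> e = sat N V \<theta>)"
  proof (cases Q)
    case Forall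
    have passes: "passes_at N V \<theta> (FinSet E) \<longleftrightarrow> (\<forall>A. \<exists>e\<in>fset E. p A e)" for E
      by (simp add: \<theta>_def q Forall passes_at_AllS p_def \<psi>_def)
    have sat: "sat N V \<theta> \<longleftrightarrow> (\<forall>A. s A)"
      by (simp add: \<theta>_def q Forall s_def \<psi>_def)
    show ?thesis
    proof (cases "\<forall>A. s A")
      case True
      then show ?thesis
        using hitting_notion[of True] passes sat by metis
    next
      case False
      then obtain A where "\<not> s A" by blast
      then show ?thesis
        using instance_notion[of A] passes sat by metis
    qed
  next
    case Exists
    have passes: "passes_at N V \<theta> (FinSet E) \<longleftrightarrow> (\<exists>A. \<forall>e\<in>fset E. p A e)" for E
      by (simp add: \<theta>_def q Exists passes_at_ExS p_def \<psi>_def)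
    have sat: "sat N V \<theta> \<longleftrightarrow> (\<exists>A. s A)"
      by (simp add: \<theta>_def q Exists s_def \<psi>_def)
    show ?thesis
    proof (cases "\<exists>A. s A")
      case True
      then obtain A where "s A" by blast
      then show ?thesis
        using instance_notion[of A] passes sat by metis
    next
      case False
      then show ?thesis
        using hitting_notion[of False] passes sat by metis
    qed
  qed
  then show ?case
    by (simp only: \<theta>_def list.size add_Suc_right add_0_right)
qed

text \<open>\<open>N\<close> and \<open>M\<close> are unrelated because evaluation at level 0
  overwrites \<open>y\<close>, the only number variable that \<open>P\<close> may contain. The lemma
  removes the assignments from \<open>passes\<close>.\<close>

lemma passes_at_cong:
  assumes "free_num_vars P \<subseteq> {y}"
    and "\<And>X. X \<in> free_set_vars P - snd ` set Qs \<Longrightarrow> V X = W X"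
  shows "passes_at N V (set_quantify Qs (inf_often x y P)) e =
    passes_at M W (set_quantify Qs (inf_often x y P)) e"
  using assms(2)
proof (induction Qs arbitrary: V W e)
  case Nil
  have "sat (N(y := k)) V P = sat (M(y := k)) W P" for k
    using assms(1) Nil by (intro sat_cong) auto
  then show ?case
    by (cases e) (simp_all add: passes_at_inf_often not_passes_at_wrong_level)
next
  case (Cons q Qs)
  obtain Q X where q: "q = (Q, X)"
    by fastforce
  have "passes_at N (V(X := A)) (set_quantify Qs (inf_often x y P)) e =
      passes_at M (W(X := A)) (set_quantify Qs (inf_often x y P)) e" for A e
    using Cons.prems by (intro Cons.IH) (auto simp: q)
  then show ?case
    by (cases Q; cases e)
      (simp_all add: q passes_at_AllS passes_at_ExS not_passes_at_wrong_level)
qed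

lemma set_quantify_append: "set_quantify (Qs @ Qs') \<phi> = set_quantify Qs (set_quantify Qs' \<phi>)"
  by (induction Qs \<phi> rule: set_quantify.induct) auto

lemma free_vars_set_quantify:
  "free_num_vars (set_quantify Qs \<phi>) = free_num_vars \<phi>"
  "free_set_vars (set_quantify Qs \<phi>) = free_set_vars \<phi> - snd ` set Qs"
  by (induction Qs \<phi> rule: set_quantify.induct) auto

theorem theorem6p6:
  fixes \<sigma> \<theta> :: formula and n :: nat
  assumes "sentence \<sigma>"
    and "n > 0"
    and "normal_form n \<theta>"
    and "equivalent \<theta> \<sigma> \<or> equivalent \<theta> (Neg \<sigma>)"
  shows "\<exists>R. valid_notion n R \<and>
    (\<forall>e\<in>R. passes \<theta> e \<longleftrightarrow> true_formula \<theta>) \<and>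
    (equivalent \<theta> \<sigma> \<longrightarrow> (\<forall>e\<in>R. true_formula \<sigma> \<longleftrightarrow> passes \<theta> e)) \<and>
    (equivalent \<theta> (Neg \<sigma>) \<longrightarrow> (\<forall>e\<in>R. true_formula \<sigma> \<longleftrightarrow> \<not> passes \<theta> e))"
proof -
  obtain Qs X x y P where n: "n = length Qs + 1"
    and \<theta>: "\<theta> = set_quantify Qs (ExS X (inf_often x y P))"
    and xy: "x \<noteq> y" and P: "bounded_formula P" "free_num_vars P \<subseteq> {y}"
      "free_set_vars P \<subseteq> insert X (snd ` set Qs)"
    using assms(3) unfolding normal_form_def by blast
  \<comment> \<open>The innermost existential set quantifier joins the prefix, whose length is then
    the level \<open>n\<close>.\<close>
  define Qs' where "Qs' = Qs @ [(Exists, X)]"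
  have \<theta>': "\<theta> = set_quantify Qs' (inf_often x y P)"
    by (simp add: \<theta> Qs'_def set_quantify_append)
  \<comment> \<open>Arbitrary values: a notion is available only for a fixed assignment, and
    \<open>\<theta>\<close> is closed.\<close>
  define N0 :: num_assignment where "N0 = (\<lambda>_. 0)"
  define V0 :: set_assignment where "V0 = (\<lambda>_ _. False)"
  obtain R where R: "valid_notion (length Qs') R" "\<forall>e\<in>R. passes_at N0 V0 \<theta> e = sat N0 V0 \<theta>"
    using ex_notion_agreeing_with_sat[of x y P Qs' N0 V0] xy P unfolding \<theta>' by blast
  have closed: "free_num_vars \<theta> = {}" "free_set_vars \<theta> = {}"
    using P by (auto simp: \<theta>' free_vars_set_quantify inf_often_def Qs'_def)
  have passes: "passes \<theta> e \<longleftrightarrow> passes_at N0 V0 \<theta> e" for e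
  proof -
    have "passes_at N V \<theta> e = passes_at N0 V0 \<theta> e" for N V
      unfolding \<theta>' using P by (intro passes_at_cong) (auto simp: Qs'_def)
    then show ?thesis
      unfolding passes_def by blast
  qed
  have sat: "sat N V \<theta> = sat N0 V0 \<theta>" for N V
    using closed by (intro sat_cong) auto
  have true: "true_formula \<theta> \<longleftrightarrow> sat N V \<theta>" for N V
    unfolding true_formula_def using sat by blast
  have "\<forall>e\<in>R. passes \<theta> e \<longleftrightarrow> true_formula \<theta>"
    using R(2) passes true by blast
  moreover have "true_formula \<sigma> \<longleftrightarrow> true_formula \<theta>" if "equivalent \<theta> \<sigma>"
    using that unfolding equivalent_def true_formula_def by blast
  \<comment> \<open>Falsity under every assignment equals failure of truth under every assignment
    only because the value of \<open>\<theta>\<close> is constant, which is what \<open>true\<close>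
    provides.\<close>
  moreover have "true_formula \<sigma> \<longleftrightarrow> \<not> true_formula \<theta>" if "equivalent \<theta> (Neg \<sigma>)"
    using that true unfolding equivalent_def true_formula_def[of \<sigma>] sat.simps by blast
  moreover have "length Qs' = n"
    by (simp add: n Qs'_def)
  ultimately show ?thesis
    using R(1) by blast
qed

end
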